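(* Let $(X,X_+,\mathcal K,f)$ be an abstract state space. Assume that $T\in\Sigma(X)$ and $T$ is mean ergodic with its limiting projection $Q_T$. Then the following statements are equivalent: (i) $T$ is uniformly mean ergodic; (ii) there exists an $n_0\in\mathbb N$ such that $\delta_{Q_T}(A_{n_0}(T))<1$. Moreover, for $n_0$ as in (ii) and $n\in\mathbb N$, $$\|A_n(T)-Q_T\|\le \frac{2(n_0+1)}{1-\delta_{Q_T}(A_{n_0}(T))}\cdot\frac1n .$$
   Context: Let $X$ be a real ordered vector space with generating cone $X_+$ ($X=X_+-X_+$), let $f$ be a strictly positive linear functional on $X$ ($f(x)>0$ for $x>0$), and let $\mathcal K=\{x\in X_+: f(x)=1\}$. Let $U$ be the convex hull of $\mathcal K\cup(-\mathcal K)$ and $\|x\|=\inf\{t\ge 0: x\in tU\}$. $(X,X_+,\mathcal K,f)$ is an abstract state space if this seminorm is a norm, $X$ is complete for it, and $X_+$ is closed; $X$ always carries this norm. A linear operator $T:X\to X$ is Markov if it is positive ($Tx\ge0$ whenever $x\ge0$) and $T(\mathcal K)\subset\mathcal K$; $\Sigma(X)$ is the set of Markov operators on $X$. Put $A_n(T)=\frac1n\sum_{k=1}^nT^k$. $T$ is mean ergodic if there is an operator $Q$ on $X$ with $\lim_{n\to\infty}A_n(T)x=Qx$ for every $x\in X$; then $Q$ is a projection, called the limiting projection of $T$ and denoted $Q_T$ (it is Markov when $T$ is). $T$ is uniformly mean ergodic if $\lim_{n\to\infty}\|A_n(T)-Q\|=0$ for some operator $Q$ on $X$. For a non-trivial projection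 $P$ on $X$ (linear, $P^2=P$) and a bounded linear operator $S$ on $X$, $\delta_P(S)=\sup\{\|Sx\|/\|x\| : Px=0,\ x\ne0\}$; if $P=I$ (the identity), one puts $\delta_P(S)=1$. $\mathbb N=\{1,2,\dots\}$.
   Formalization: The case Q_T = I (equivalently T = I) is excluded: there A_n(T) = Q_T = I, so (i) holds, while the convention δ_I(S) = 1 makes (ii) fail for every n_0, so the stated equivalence is false. *)

theory Defs
  imports "HOL-Analysis.Analysis"
begin

definition state_base :: "('a::ordered_real_vector \<Rightarrow> real) \<Rightarrow> 'a set" where
  "state_base f = {x. 0 \<le> x \<and> f x = 1}"

definition state_ball :: "('a::ordered_real_vector \<Rightarrow> real) \<Rightarrow> 'a set" where
  "state_ball f = convex hull (state_base f \<union> uminus ` state_base f)"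

(* The space X is the type 'a with its order. The norm of the class banach is required to be
   the gauge of state_ball f; that this gauge is a norm and that X is complete for it are then
   the axioms of the class. On the zero space state_base f is empty and the infimum
   unspecified. *)
definition abstract_state_space :: "('a::{ordered_real_vector, banach} \<Rightarrow> real) \<Rightarrow> bool" where
  "abstract_state_space f \<longleftrightarrow>
     linear f \<and>
     (\<forall>x>0. 0 < f x) \<and>
     (\<forall>x::'a. \<exists>y\<ge>0. \<exists>z\<ge>0. x = y - z) \<and>
     (\<forall>x. norm x = Inf {t. 0 \<le> t \<and> x \<in> (*\<^sub>R) t ` state_ball f}) \<and>
     closed {x::'a. 0 \<le> x}"

definition markov_operator :: "('a::ordered_real_vector \<Rightarrow> real) \<Rightarrow> ('a \<Rightarrow> 'a) \<Rightarrow> bool" where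
  "markov_operator f T \<longleftrightarrow>
     linear T \<and> (\<forall>x\<ge>0. 0 \<le> T x) \<and> T ` state_base f \<subseteq> state_base f"

definition ergodic_mean :: "nat \<Rightarrow> ('a::real_vector \<Rightarrow> 'a) \<Rightarrow> 'a \<Rightarrow> 'a" where
  "ergodic_mean n T x = (1 / real n) *\<^sub>R (\<Sum>k=1..n. (T ^^ k) x)"

definition mean_ergodic :: "('a::real_normed_vector \<Rightarrow> 'a) \<Rightarrow> bool" where
  "mean_ergodic T \<longleftrightarrow>
     (\<exists>Q. linear Q \<and> (\<forall>x. (\<lambda>n. ergodic_mean n T x) \<longlonglongrightarrow> Q x))"

(* Meaningful only for mean ergodic T. *)
definition limiting_projection :: "('a::real_normed_vector \<Rightarrow> 'a) \<Rightarrow> 'a \<Rightarrow> 'a" where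
  "limiting_projection T = (\<lambda>x. lim (\<lambda>n. ergodic_mean n T x))"

(* Q is required to be bounded because onorm is a genuine supremum only for bounded operators. *)
definition uniformly_mean_ergodic :: "('a::real_normed_vector \<Rightarrow> 'a) \<Rightarrow> bool" where
  "uniformly_mean_ergodic T \<longleftrightarrow>
     (\<exists>Q. bounded_linear Q \<and> (\<lambda>n. onorm (\<lambda>x. ergodic_mean n T x - Q x)) \<longlonglongrightarrow> 0)"

(* Intended for a linear projection P and a bounded linear S: if P is not the identity, its
   kernel is non-zero, so the supremum is over a non-empty set that is bounded above. *)
definition ergodicity_coeff ::
  "('a::real_normed_vector \<Rightarrow> 'a) \<Rightarrow> ('a \<Rightarrow> 'a) \<Rightarrow> real" where
  "ergodicity_coeff P S =
     (if P = id then 1 else (SUP x\<in>{x. P x = 0 \<and> x \<noteq> 0}. norm (S x) / norm x))"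

end

theory Submission
  imports Defs
begin

text \<open>
  The order structure enters through one fact: a Markov operator maps the unit ball of the
  base norm into itself, so it is a contraction (\<open>markov_operator_contraction\<close>). The rest is
  ergodic theory of a linear contraction \<open>T\<close> on a normed space, with means \<open>A n\<close> and pointwise
  limit \<open>Q\<close>.

  The sum \<open>T (A n x) - A n x\<close> telescopes to \<open>(T^(n+1) x - T x) / n\<close>, which has norm at most
  \<open>2 * norm x / n\<close>. Hence \<open>Q\<close> is a projection with \<open>Q T = T Q = Q\<close>, it absorbs all means, and
  \<open>A n - Q = A n (I - Q)\<close>; it thus suffices to estimate \<open>A n\<close> on the kernel of \<open>Q\<close>, and the
  passage to that kernel costs a factor \<open>2\<close>. Adding up telescoped steps and averaging over
  exponents \<open>k = 1, \<dots>, m\<close> shows that a further mean hardly changes \<open>A n x\<close>: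
  the norm of \<open>A m (A n x) - A n x\<close> is at most \<open>(m + 1) / n * norm x\<close>.
  If the ergodicity coefficient \<open>d\<close> of \<open>A m\<close> is below \<open>1\<close>, then \<open>A m\<close> shrinks the vector
  \<open>y = A n x\<close> of the kernel by the factor \<open>d\<close>, whence
  \<open>(1 - d) * norm y \<le> norm (y - A m y)\<close>, and so
  \<open>norm (A n x) \<le> (m + 1) / ((1 - d) * n) * norm x\<close> on the kernel. Together with the factor \<open>2\<close>
  this is the asserted rate, and it gives uniform convergence.

  Conversely, the coefficient of \<open>A n\<close> is at most the operator norm of \<open>A n - Q\<close>, which is
  eventually below \<open>1\<close> when the convergence is uniform.
\<close>

section \<open>Markov operators are contractions for the base norm\<close>

text \<open>
  Decomposing \<open>x = y - z\<close> into positive parts and normalising each of them by \<open>f\<close> puts \<open>x\<close> into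
  the multiple of the ball by \<open>f y + f z\<close>. The ball is therefore absorbing, so the infimum
  defining the norm is taken over a non-empty set.
\<close>
lemma state_ball_absorbing:
  fixes f :: "'a::{ordered_real_vector, banach} \<Rightarrow> real"
  assumes ass: "abstract_state_space f" and nontriv: "\<exists>x::'a. x \<noteq> 0"
  shows "\<exists>t\<ge>0. x \<in> (*\<^sub>R) t ` state_ball f"
proof -
  have lin: "linear f" and pos: "\<And>x. 0 < x \<Longrightarrow> 0 < f x"
    and gen: "\<And>x::'a. \<exists>y\<ge>0. \<exists>z\<ge>0. x = y - z"
    using ass unfolding abstract_state_space_def by blast+
  have normalise: "(1 / f y) *\<^sub>R y \<in> state_base f" if "0 < y" for y
    using pos[OF that] that
    by (simp add: state_base_def linear_scale[OF lin] scaleR_nonneg_nonneg less_imp_le)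
  obtain k where k: "k \<in> state_base f"
  proof -
    obtain x0 :: 'a where "x0 \<noteq> 0" using nontriv by blast
    moreover obtain y z where "0 \<le> y" "0 \<le> z" "x0 = y - z" using gen by blast
    ultimately have "0 < y \<or> 0 < z" by (auto simp: less_le)
    then show ?thesis using normalise that by blast
  qed
  have multiple: "\<exists>u\<in>state_base f. y = f y *\<^sub>R u \<and> 0 \<le> f y" if "0 \<le> y" for y
  proof (cases "y = 0")
    case True
    then show ?thesis using k linear_0[OF lin] by auto
  next
    case False
    then have "0 < y" using that by (simp add: less_le)
    then show ?thesis using normalise[of y] pos[of y]
      by (intro bexI[of _ "(1 / f y) *\<^sub>R y"]) auto
  qed
  obtain y z where yz: "0 \<le> y" "0 \<le> z" "x = y - z" using gen by blast
  obtain u where u: "u \<in> state_base f" "y = f y *\<^sub>R u" "0 \<le> f y"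
    using multiple[OF yz(1)] by blast
  obtain v where v: "v \<in> state_base f" "z = f z *\<^sub>R v" "0 \<le> f z"
    using multiple[OF yz(2)] by blast
  have uU: "u \<in> state_ball f" and vU: "- v \<in> state_ball f"
    using u(1) v(1) unfolding state_ball_def by (auto intro: hull_inc)
  show ?thesis
  proof (cases "f y + f z = 0")
    case True
    then have "f y = 0" "f z = 0" using u(3) v(3) by auto
    then have "x = 0 *\<^sub>R u" using yz(3) u(2) v(2) by simp
    then show ?thesis using uU by blast
  next
    case False
    define s where "s = f y + f z"
    have s: "0 < s" using False u(3) v(3) by (simp add: s_def)
    define w where "w = (f y / s) *\<^sub>R u + (f z / s) *\<^sub>R (- v)"
    have "w \<in> state_ball f"
      unfolding w_def using uU vU u(3) v(3) s
      by (intro convexD[OF convex_convex_hull[of "state_base f \<union> uminus ` state_base f",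
            folded state_ball_def]])
         (auto simp: s_def add_divide_distrib[symmetric])
    moreover have "s *\<^sub>R w = f y *\<^sub>R u - f z *\<^sub>R v"
      using s by (simp add: w_def scaleR_diff_right)
    then have "x = s *\<^sub>R w" using yz(3) u(2) v(2) by simp
    ultimately show ?thesis using s by (intro exI[of _ s]) auto
  qed
qed

lemma markov_operator_state_ball:
  assumes "markov_operator f T"
  shows "T ` state_ball f \<subseteq> state_ball f"
proof -
  have lin: "linear T" and base: "T ` state_base f \<subseteq> state_base f"
    using assms unfolding markov_operator_def by auto
  have "T ` state_ball f = convex hull (T ` (state_base f \<union> uminus ` state_base f))"
    unfolding state_ball_def by (rule convex_hull_linear_image[OF lin])
  also have "\<dots> \<subseteq> state_ball f"
    unfolding state_ball_def using base
    by (intro hull_mono) (auto simp: linear_neg[OF lin])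
  finally show ?thesis .
qed

text \<open>
  On the zero space the defining infimum ranges over the empty set, but there the claim is trivial.
\<close>
lemma markov_operator_contraction:
  fixes f :: "'a::{ordered_real_vector, banach} \<Rightarrow> real"
  assumes ass: "abstract_state_space f" and T: "markov_operator f T"
  shows "norm (T x) \<le> norm x"
proof (cases "\<exists>x::'a. x \<noteq> 0")
  case False
  then have "T x = 0" by blast
  then show ?thesis by simp
next
  case True
  let ?D = "\<lambda>x. {t. 0 \<le> t \<and> x \<in> (*\<^sub>R) t ` state_ball f}"
  have norm_eq: "norm x = Inf (?D x)" for x
    using ass unfolding abstract_state_space_def by blast
  have lin: "linear T" using T unfolding markov_operator_def by blast
  have "?D x \<noteq> {}" using state_ball_absorbing[OF ass True, of x] by blast
  moreover have "bdd_below (?D (T x))" by (rule bdd_belowI[of _ 0]) auto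
  moreover have "?D x \<subseteq> ?D (T x)"
    using markov_operator_state_ball[OF T]
    by (fastforce simp: linear_scale[OF lin] image_subset_iff)
  ultimately have "Inf (?D (T x)) \<le> Inf (?D x)" by (rule cInf_superset_mono)
  then show ?thesis by (simp only: norm_eq)
qed

section \<open>Mean ergodic contractions\<close>

locale mean_ergodic_contraction =
  fixes T :: "'a::real_normed_vector \<Rightarrow> 'a"
  assumes linear_T: "linear T"
    and contraction: "norm (T x) \<le> norm x"
    and mean_ergodic_T: "mean_ergodic T"
begin

abbreviation A :: "nat \<Rightarrow> 'a \<Rightarrow> 'a" where "A n \<equiv> ergodic_mean n T"
abbreviation Q :: "'a \<Rightarrow> 'a" where "Q \<equiv> limiting_projection T"

lemma bounded_linear_T: "bounded_linear T"
  by (rule bounded_linear_intro[where K = 1])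
     (simp_all add: linear_add[OF linear_T] linear_scale[OF linear_T] contraction)

lemma linear_pow: "linear (T ^^ k)"
proof (induction k)
  case 0
  show ?case by (simp only: funpow.simps linear_id)
next
  case (Suc k)
  then show ?case unfolding funpow.simps by (rule linear_compose[OF _ linear_T])
qed

lemma norm_pow_le: "norm ((T ^^ k) x) \<le> norm x"
  by (induction k) (auto intro: order_trans[OF contraction])

lemma linear_mean: "linear (A n)"
  unfolding ergodic_mean_def
  by (intro linear_compose_scale_right linear_compose_sum ballI linear_pow)

lemma norm_mean_le: "norm (A n x) \<le> norm x"
proof (cases "n = 0")
  case True
  then show ?thesis by (simp add: ergodic_mean_def)
next
  case False
  have "norm (\<Sum>k=1..n. (T ^^ k) x) \<le> (\<Sum>k=1..n. norm x)"
    by (intro sum_norm_le norm_pow_le)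
  then show ?thesis using False by (simp add: ergodic_mean_def divide_simps mult.commute)
qed

lemma bounded_linear_mean: "bounded_linear (A n)"
  by (rule bounded_linear_intro[where K = 1])
     (simp_all add: linear_add[OF linear_mean] linear_scale[OF linear_mean] norm_mean_le)

lemma mean_tendsto: "(\<lambda>n. A n x) \<longlonglongrightarrow> Q x"
proof -
  have "convergent (\<lambda>n. A n x)"
    using mean_ergodic_T unfolding mean_ergodic_def by (auto intro: convergentI)
  then show ?thesis
    by (simp add: limiting_projection_def convergent_LIMSEQ_iff)
qed

lemma linear_Q: "linear Q"
proof -
  obtain Q' where Q': "linear Q'" "\<And>x. (\<lambda>n. A n x) \<longlonglongrightarrow> Q' x"
    using mean_ergodic_T unfolding mean_ergodic_def by blast
  then have "Q = Q'" by (intro ext LIMSEQ_unique[OF mean_tendsto])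
  then show ?thesis using Q'(1) by simp
qed

lemma norm_Q_le: "norm (Q x) \<le> norm x"
  using norm_mean_le by (intro Lim_bounded[OF tendsto_norm[OF mean_tendsto]]) auto

lemma mean_T: "A n (T x) = T (A n x)"
  by (simp add: ergodic_mean_def linear_scale[OF linear_T] linear_sum[OF linear_T]
      funpow_swap1[symmetric])

lemma T_mean_minus_mean: "T (A n x) - A n x = (1 / real n) *\<^sub>R ((T ^^ Suc n) x - T x)"
proof -
  have "T (\<Sum>k=1..n. (T ^^ k) x) - (\<Sum>k=1..n. (T ^^ k) x)
      = (\<Sum>k=1..n. (T ^^ Suc k) x - (T ^^ k) x)"
    by (simp add: linear_sum[OF linear_T] sum_subtractf)
  also have "\<dots> = (T ^^ Suc n) x - T x"
    by (subst sum_Suc_diff) auto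
  finally show ?thesis
    by (simp add: ergodic_mean_def linear_scale[OF linear_T] scaleR_diff_right[symmetric])
qed

lemma norm_T_mean_minus_mean: "norm (T (A n x) - A n x) \<le> 2 / real n * norm x"
proof -
  have "norm ((T ^^ Suc n) x - T x) \<le> norm x + norm x"
    using norm_triangle_ineq4 norm_pow_le contraction by (meson add_mono order_trans)
  then show ?thesis
    unfolding T_mean_minus_mean by (simp add: divide_right_mono)
qed

lemma norm_pow_mean_minus_mean: "norm ((T ^^ k) (A n x) - A n x) \<le> 2 * real k / real n * norm x"
proof (induction k)
  case 0
  then show ?case by simp
next
  case (Suc k)
  have "(T ^^ Suc k) (A n x) - A n x
      = (T ^^ k) (T (A n x) - A n x) + ((T ^^ k) (A n x) - A n x)"
    by (simp add: linear_diff[OF linear_pow] funpow_swap1)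
  also have "norm \<dots> \<le> norm (T (A n x) - A n x) + 2 * real k / real n * norm x"
    by (rule norm_triangle_mono[OF norm_pow_le Suc.IH])
  also have "\<dots> \<le> 2 / real n * norm x + 2 * real k / real n * norm x"
    using norm_T_mean_minus_mean by simp
  finally show ?case by (simp add: add_divide_distrib algebra_simps)
qed

text \<open>
  Averaging the bounds \<open>2 * k / n\<close> of the single powers over \<open>k = 1, \<dots>, m\<close> gives \<open>(m + 1) / n\<close>.
\<close>
lemma norm_mean_mean_minus_mean:
  assumes "m \<ge> 1"
  shows "norm (A m (A n x) - A n x) \<le> (real m + 1) / real n * norm x"
proof -
  have gauss: "(\<Sum>k=1..m. 2 * real k) = real m * (real m + 1)"
    by (induction m) (auto simp: algebra_simps)
  have "A m (A n x) - A n x = (1 / real m) *\<^sub>R (\<Sum>k=1..m. (T ^^ k) (A n x) - A n x)"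
    using assms
    by (simp add: ergodic_mean_def[of m] sum_subtractf sum_constant_scaleR scaleR_diff_right)
  also have "norm \<dots> \<le> (1 / real m) * (\<Sum>k=1..m. 2 * real k / real n * norm x)"
    unfolding norm_scaleR by (auto intro!: mult_left_mono sum_norm_le norm_pow_mean_minus_mean
        simp del: times_divide_eq_left times_divide_eq_right)
  also have "(\<Sum>k=1..m. 2 * real k / real n * norm x) = (\<Sum>k=1..m. 2 * real k) / real n * norm x"
    by (simp add: sum_distrib_right sum_divide_distrib)
  finally show ?thesis using assms unfolding gauss by (simp add: mult.assoc)
qed

lemma T_Q: "T (Q x) = Q x"
proof -
  have "(\<lambda>n. 2 / real n * norm x) \<longlonglongrightarrow> 0"
    by (intro tendsto_mult_left_zero lim_const_over_n)
  then have "(\<lambda>n. T (A n x) - A n x) \<longlonglongrightarrow> 0"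
    by (rule Lim_null_comparison[OF always_eventually, rotated])
       (intro allI norm_T_mean_minus_mean)
  moreover have "(\<lambda>n. T (A n x) - A n x) \<longlonglongrightarrow> T (Q x) - Q x"
    by (intro tendsto_diff bounded_linear.tendsto[OF bounded_linear_T] mean_tendsto)
  ultimately have "T (Q x) - Q x = 0" by (rule LIMSEQ_unique[rotated])
  then show ?thesis by simp
qed

lemma Q_T: "Q (T x) = Q x"
proof -
  have "(\<lambda>n. T (A n x)) \<longlonglongrightarrow> Q (T x)" using mean_tendsto[of "T x"] by (simp add: mean_T)
  moreover have "(\<lambda>n. T (A n x)) \<longlonglongrightarrow> T (Q x)"
    by (intro bounded_linear.tendsto[OF bounded_linear_T] mean_tendsto)
  ultimately have "Q (T x) = T (Q x)" by (rule LIMSEQ_unique)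
  then show ?thesis by (simp add: T_Q)
qed

lemma pow_Q: "(T ^^ k) (Q x) = Q x"
  by (induction k) (auto simp: T_Q)

lemma Q_pow: "Q ((T ^^ k) x) = Q x"
  by (induction k) (auto simp: Q_T)

lemma mean_Q: "n \<ge> 1 \<Longrightarrow> A n (Q x) = Q x"
  by (simp add: ergodic_mean_def pow_Q sum_constant_scaleR)

lemma Q_mean: "n \<ge> 1 \<Longrightarrow> Q (A n x) = Q x"
  by (simp add: ergodic_mean_def linear_scale[OF linear_Q] linear_sum[OF linear_Q] Q_pow
      sum_constant_scaleR)

lemma Q_Q: "Q (Q x) = Q x"
proof -
  have "(\<lambda>n. A n (Q x)) \<longlonglongrightarrow> Q x"
    by (rule tendsto_eventually) (auto simp: mean_Q intro: eventually_sequentiallyI[of 1])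
  with mean_tendsto show ?thesis by (rule LIMSEQ_unique)
qed

lemma bounded_linear_Q: "bounded_linear Q"
  by (rule bounded_linear_intro[where K = 1])
     (simp_all add: linear_add[OF linear_Q] linear_scale[OF linear_Q] norm_Q_le)

lemma kernel_Q_nontrivial:
  assumes "Q \<noteq> id"
  shows "{x. Q x = 0 \<and> x \<noteq> 0} \<noteq> {}"
proof -
  obtain x where "Q x \<noteq> x" using assms by (auto simp: fun_eq_iff)
  then have "Q (x - Q x) = 0 \<and> x - Q x \<noteq> 0"
    using linear_diff[OF linear_Q] Q_Q by auto
  then show ?thesis by blast
qed

section \<open>Uniform convergence and the ergodicity coefficient\<close>

lemma norm_mean_le_coeff:
  assumes "Q \<noteq> id" and "Q y = 0"
  shows "norm (A m y) \<le> ergodicity_coeff Q (A m) * norm y"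
proof (cases "y = 0")
  case True
  then show ?thesis using linear_0[OF linear_mean] by simp
next
  case False
  let ?K = "{x. Q x = 0 \<and> x \<noteq> 0}"
  have "bdd_above ((\<lambda>x. norm (A m x) / norm x) ` ?K)"
    using norm_mean_le by (intro bdd_aboveI2[of _ _ 1]) (simp add: divide_le_eq)
  then have "norm (A m y) / norm y \<le> (SUP x\<in>?K. norm (A m x) / norm x)"
    using False assms(2) by (intro cSUP_upper) auto
  then show ?thesis
    using False assms(1) by (simp add: ergodicity_coeff_def pos_divide_le_eq)
qed

text \<open>
  The mean \<open>A n x\<close> stays in the kernel of \<open>Q\<close>. There \<open>A m\<close> shrinks it by the coefficient, and yet
  moves it by no more than \<open>(m + 1) / n * norm x\<close>; both are possible only if it is small.
\<close>
lemma norm_mean_kernel_le: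
  assumes Q: "Q \<noteq> id" and m: "m \<ge> 1" and n: "n \<ge> 1"
    and d: "ergodicity_coeff Q (A m) < 1" and x: "Q x = 0"
  shows "norm (A n x) \<le> (real m + 1) / (1 - ergodicity_coeff Q (A m)) * (1 / real n) * norm x"
proof -
  let ?d = "ergodicity_coeff Q (A m)"
  have "norm (A n x) \<le> norm (A m (A n x)) + norm (A m (A n x) - A n x)"
    using norm_triangle_sub[of "A n x" "A m (A n x)"] by (simp add: norm_minus_commute)
  also have "\<dots> \<le> ?d * norm (A n x) + (real m + 1) / real n * norm x"
    using norm_mean_le_coeff[OF Q, of "A n x"] norm_mean_mean_minus_mean[OF m] Q_mean[OF n] x
    by (intro add_mono) auto
  finally have "(1 - ?d) * norm (A n x) \<le> (real m + 1) / real n * norm x"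
    by (simp add: algebra_simps)
  then have "norm (A n x) \<le> ((real m + 1) / real n * norm x) / (1 - ?d)"
    using d by (subst pos_le_divide_eq) (simp_all add: mult.commute)
  then show ?thesis by (simp add: mult_ac)
qed

lemma onorm_mean_minus_Q_le:
  assumes Q: "Q \<noteq> id" and m: "m \<ge> 1" and n: "n \<ge> 1"
    and d: "ergodicity_coeff Q (A m) < 1"
  shows "onorm (\<lambda>x. A n x - Q x)
    \<le> 2 * (real m + 1) / (1 - ergodicity_coeff Q (A m)) * (1 / real n)"
proof (rule onorm_bound)
  let ?c = "(real m + 1) / (1 - ergodicity_coeff Q (A m)) * (1 / real n)"
  have c: "0 \<le> ?c" using d by simp
  then show "0 \<le> 2 * (real m + 1) / (1 - ergodicity_coeff Q (A m)) * (1 / real n)"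
    using d by simp
  fix x
  have "A n x - Q x = A n (x - Q x)"
    using linear_diff[OF linear_mean] mean_Q[OF n] by simp
  also have "norm \<dots> \<le> ?c * norm (x - Q x)"
    using linear_diff[OF linear_Q] Q_Q by (intro norm_mean_kernel_le[OF Q m n d]) simp
  also have "\<dots> \<le> ?c * (norm x + norm x)"
    using norm_triangle_ineq4[of x "Q x"] norm_Q_le[of x] by (intro mult_left_mono[OF _ c]) simp
  also have "\<dots> = 2 * (real m + 1) / (1 - ergodicity_coeff Q (A m)) * (1 / real n) * norm x"
    by (simp add: algebra_simps add_divide_distrib)
  finally show "norm (A n x - Q x)
      \<le> 2 * (real m + 1) / (1 - ergodicity_coeff Q (A m)) * (1 / real n) * norm x" .
qed

lemma coeff_less_1_imp_uniformly_mean_ergodic: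
  assumes "Q \<noteq> id" "m \<ge> 1" "ergodicity_coeff Q (A m) < 1"
  shows "uniformly_mean_ergodic T"
proof -
  let ?C = "2 * (real m + 1) / (1 - ergodicity_coeff Q (A m))"
  have "(\<lambda>n. ?C * (1 / real n)) \<longlonglongrightarrow> 0"
    by (intro tendsto_mult_right_zero lim_1_over_n)
  moreover have "\<forall>\<^sub>F n in sequentially. norm (onorm (\<lambda>x. A n x - Q x)) \<le> ?C * (1 / real n)"
    using onorm_mean_minus_Q_le[OF assms(1,2) _ assms(3)]
      onorm_pos_le[OF bounded_linear_sub[OF bounded_linear_mean bounded_linear_Q]]
    by (intro eventually_sequentiallyI[of 1]) simp
  ultimately have "(\<lambda>n. onorm (\<lambda>x. A n x - Q x)) \<longlonglongrightarrow> 0"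
    by (rule Lim_null_comparison[rotated])
  then show ?thesis
    unfolding uniformly_mean_ergodic_def using bounded_linear_Q by blast
qed

text \<open>Uniform convergence implies pointwise convergence, so the uniform limit can only be \<open>Q\<close>.\<close>
lemma uniformly_mean_ergodic_onorm_tendsto:
  assumes "uniformly_mean_ergodic T"
  shows "(\<lambda>n. onorm (\<lambda>x. A n x - Q x)) \<longlonglongrightarrow> 0"
proof -
  obtain R where R: "bounded_linear R" and lim: "(\<lambda>n. onorm (\<lambda>x. A n x - R x)) \<longlonglongrightarrow> 0"
    using assms unfolding uniformly_mean_ergodic_def by blast
  have "R x = Q x" for x
  proof -
    have "(\<lambda>n. onorm (\<lambda>x. A n x - R x) * norm x) \<longlonglongrightarrow> 0"
      by (intro tendsto_mult_left_zero lim)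
    then have "(\<lambda>n. A n x - R x) \<longlonglongrightarrow> 0"
      by (rule Lim_null_comparison[OF always_eventually, rotated])
         (simp add: onorm[OF bounded_linear_sub[OF bounded_linear_mean R]])
    then have "(\<lambda>n. A n x) \<longlonglongrightarrow> R x" by (rule LIM_zero_cancel)
    then show ?thesis using mean_tendsto by (rule LIMSEQ_unique)
  qed
  then show ?thesis using lim by simp
qed

lemma coeff_le_onorm:
  assumes "Q \<noteq> id"
  shows "ergodicity_coeff Q (A n) \<le> onorm (\<lambda>x. A n x - Q x)"
proof -
  have "norm (A n x) / norm x \<le> onorm (\<lambda>x. A n x - Q x)" if "Q x = 0" "x \<noteq> 0" for x
    using onorm[OF bounded_linear_sub[OF bounded_linear_mean bounded_linear_Q], of n x] that
    by (simp add: pos_divide_le_eq)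
  then have "(SUP x\<in>{x. Q x = 0 \<and> x \<noteq> 0}. norm (A n x) / norm x) \<le> onorm (\<lambda>x. A n x - Q x)"
    by (intro cSUP_least[OF kernel_Q_nontrivial[OF assms]]) auto
  then show ?thesis using assms by (simp add: ergodicity_coeff_def)
qed

lemma uniformly_mean_ergodic_imp_coeff_less_1:
  assumes "Q \<noteq> id" "uniformly_mean_ergodic T"
  shows "\<exists>m\<ge>1. ergodicity_coeff Q (A m) < 1"
proof -
  have "\<forall>\<^sub>F n in sequentially. onorm (\<lambda>x. A n x - Q x) < 1"
    using order_tendstoD(2)[OF uniformly_mean_ergodic_onorm_tendsto[OF assms(2)]] by simp
  then have "\<forall>\<^sub>F n in sequentially. 1 \<le> n \<and> onorm (\<lambda>x. A n x - Q x) < 1"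
    by (rule eventually_conj[OF eventually_ge_at_top])
  then obtain n where "1 \<le> n" "onorm (\<lambda>x. A n x - Q x) < 1"
    using eventually_happens'[OF sequentially_bot] by blast
  then show ?thesis using coeff_le_onorm[OF assms(1), of n] by fastforce
qed

end

section \<open>Uniform mean ergodicity of Markov operators\<close>

theorem theorem6p3:
  fixes f :: "'a::{ordered_real_vector, banach} \<Rightarrow> real"
    and T :: "'a \<Rightarrow> 'a"
  assumes "abstract_state_space f"
    and "markov_operator f T"
    and "mean_ergodic T"
    and "limiting_projection T \<noteq> id"
  shows "(uniformly_mean_ergodic T \<longleftrightarrow>
           (\<exists>n0\<ge>1. ergodicity_coeff (limiting_projection T) (ergodic_mean n0 T) < 1)) \<and>
         (\<forall>n0\<ge>1. ergodicity_coeff (limiting_projection T) (ergodic_mean n0 T) < 1 \<longrightarrow>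
           (\<forall>n\<ge>1. onorm (\<lambda>x. ergodic_mean n T x - limiting_projection T x)
              \<le> 2 * (real n0 + 1) / (1 - ergodicity_coeff (limiting_projection T) (ergodic_mean n0 T))
                  * (1 / real n)))"
proof -
  interpret mean_ergodic_contraction T
    using assms(2,3) markov_operator_contraction[OF assms(1,2)]
    by (intro mean_ergodic_contraction.intro) (auto simp: markov_operator_def)
  show ?thesis
    using uniformly_mean_ergodic_imp_coeff_less_1[OF assms(4)]
      coeff_less_1_imp_uniformly_mean_ergodic[OF assms(4)]
      onorm_mean_minus_Q_le[OF assms(4)]
    by blast
qed

end
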